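(* Let $A, A' \subseteq 2^{\mathbb{N}}$ be disjoint analytic sets. Then $A$ and $A'$ are Borel separable, i.e. there is a Borel set $S \subseteq 2^{\mathbb{N}}$ with $A \subseteq S$ and $S \cap A' = \emptyset$.
   Context: $2^{\mathbb{N}}$ is the Cantor space of infinite binary strings with its usual product topology. A set $A \subseteq 2^{\mathbb{N}}$ is analytic if there exists a Borel set $B \subseteq 2^{\mathbb{N}} \times 2^{\mathbb{N}}$ such that $A = \{x \in 2^{\mathbb{N}} : (x,y) \in B \text{ for some } y \in 2^{\mathbb{N}}\}$. *)

theory Defs
  imports "HOL-Analysis.Analysis"
begin

text \<open>
  The type \<^typ>\<open>nat \<Rightarrow> bool\<close> carries the product topology of the discrete topology on
  \<^typ>\<open>bool\<close>, so it is the Cantor space; \<^term>\<open>borel\<close> on the pair type is the Borel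
  \<open>\<sigma>\<close>-algebra of the product topology.
\<close>

type_synonym cantor = "nat \<Rightarrow> bool"

definition analytic_set :: "cantor set \<Rightarrow> bool" where
  "analytic_set A \<longleftrightarrow>
     (\<exists>B \<in> sets (borel :: (cantor \<times> cantor) measure). A = {x. \<exists>y. (x, y) \<in> B})"

end

theory Submission
  imports Defs
begin

text \<open>
  The proof represents each analytic set as the projection of a closed set
  \<open>C \<subseteq> 2\<^sup>\<nat> \<times> \<nat>\<^sup>\<nat>\<close>; an inseparable pair of such projections can then be localised at
  a pair of points, where it is refuted.

  Call a set Souslin if it is the projection of a closed subset of \<open>X \<times> \<nat>\<^sup>\<nat>\<close>. A single point
  of \<open>\<nat>\<^sup>\<nat>\<close> codes a natural number followed by a point, or a whole sequence of points, so
  Souslin sets are closed under countable unions and intersections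
  (\<open>souslin_UN\<close>, \<open>souslin_INT\<close>). Hence the sets that are Souslin together with their
  complement form a \<open>\<sigma>\<close>-algebra; it contains the clopen sets that generate the Borel sets of
  \<open>2\<^sup>\<nat> \<times> 2\<^sup>\<nat>\<close>, so every Borel set there is Souslin (\<open>borel_souslin\<close>). As \<open>2\<^sup>\<nat>\<close> is a
  continuous image of \<open>\<nat>\<^sup>\<nat>\<close>, projecting away another coordinate \<open>y \<in> 2\<^sup>\<nat>\<close> preserves the
  property (\<open>souslin_projection\<close>), and analytic sets are Souslin.

  Now let \<open>A\<close> and \<open>A'\<close> be disjoint projections of closed sets \<open>C\<close> and \<open>C'\<close>, and suppose that
  no Borel set separates them. Cut \<open>C\<close> and \<open>C'\<close> into countably many pieces by fixing the
  first entries of both components of their points. If all pairs of pieces had separable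
  projections, a countable combination of the separating sets would separate the wholes
  (\<open>borel_separated_UN\<close>); so some pair of pieces is again inseparable. Repeating this gives
  nested pieces that shrink to points \<open>(x, g)\<close> and \<open>(x', g')\<close>. No piece is empty, for otherwise it
  could be separated trivially; as \<open>C\<close> and \<open>C'\<close> are closed, \<open>(x, g) \<in> C\<close> and \<open>(x', g') \<in> C'\<close>,
  whence \<open>x \<in> A\<close> and \<open>x' \<in> A'\<close>. By disjointness \<open>x i \<noteq> x' i\<close> for some \<open>i\<close>. But then the
  clopen set of all \<open>u\<close> with \<open>u i = x i\<close> separates the pieces in which the \<open>i\<close>-th entry is
  fixed, a contradiction.
\<close>

section \<open>Projections of closed sets along the Baire space\<close>

definition souslin :: "'a::topological_space set \<Rightarrow> bool" where
  "souslin A \<longleftrightarrow> (\<exists>C :: ('a \<times> (nat \<Rightarrow> nat)) set. closed C \<and> A = fst ` C)"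

lemma closed_imp_souslin:
  assumes "closed A"
  shows "souslin A"
  unfolding souslin_def
  by (rule exI[of _ "A \<times> UNIV"]) (auto intro: closed_Times assms)

lemma continuous_on_product_coordinate_comp:
  fixes f :: "'a::topological_space \<Rightarrow> 'i \<Rightarrow> 'b::topological_space"
  assumes "continuous_on S f"
  shows "continuous_on S (\<lambda>x. f x i)"
  using continuous_on_compose2[OF continuous_on_product_coordinates assms] by simp

text \<open>The first entry of the code selects the set, the other entries are the witness.\<close>

lemma souslin_UN:
  fixes A :: "nat \<Rightarrow> 'a::topological_space set"
  assumes "\<And>n. souslin (A n)"
  shows "souslin (\<Union>n. A n)"
proof -
  obtain C :: "nat \<Rightarrow> ('a \<times> (nat \<Rightarrow> nat)) set"
    where C: "\<And>n. closed (C n)" "\<And>n. A n = fst ` C n"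
    using assms unfolding souslin_def by metis
  define h :: "'a \<times> (nat \<Rightarrow> nat) \<Rightarrow> 'a \<times> (nat \<Rightarrow> nat)"
    where "h = (\<lambda>p. (fst p, \<lambda>k. snd p (Suc k)))"
  define D where "D = {p. h p \<in> C (snd p 0)}"
  have h: "continuous_on UNIV h"
    unfolding h_def
    by (intro continuous_intros continuous_on_coordinatewise_then_product
        continuous_on_product_coordinate_comp)
  have first: "continuous_on UNIV (\<lambda>p :: 'a \<times> (nat \<Rightarrow> nat). snd p 0)"
    by (intro continuous_intros continuous_on_product_coordinate_comp)
  \<comment> \<open>An infinite union of closed sets, but locally only one of them matters: the complement is
    visibly open.\<close>
  have "- D = (\<Union>n. (\<lambda>p. snd p 0) -` {n} \<inter> h -` (- C n))"
    by (auto simp: D_def)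
  moreover have "open \<dots>"
    by (intro open_UN ballI open_Int open_vimage h first open_discrete)
      (simp add: C(1) open_Compl)
  ultimately have "closed D"
    by (simp add: closed_def)
  moreover have "(\<Union>n. A n) = fst ` D"
  proof (intro equalityI subsetI)
    fix x assume "x \<in> (\<Union>n. A n)"
    then obtain n g where "(x, g) \<in> C n"
      using C(2) by auto
    then have "(x, case_nat n g) \<in> D"
      by (simp add: D_def h_def)
    then show "x \<in> fst ` D"
      by force
  qed (force simp: D_def h_def C(2))
  ultimately show ?thesis
    unfolding souslin_def by blast
qed

text \<open>One code carries a witness for each of the sets, interleaved by a pairing function.\<close>

lemma souslin_INT:
  fixes A :: "nat \<Rightarrow> 'a::topological_space set"
  assumes "\<And>n. souslin (A n)"
  shows "souslin (\<Inter>n. A n)"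
proof -
  obtain C :: "nat \<Rightarrow> ('a \<times> (nat \<Rightarrow> nat)) set"
    where C: "\<And>n. closed (C n)" "\<And>n. A n = fst ` C n"
    using assms unfolding souslin_def by metis
  define h :: "nat \<Rightarrow> 'a \<times> (nat \<Rightarrow> nat) \<Rightarrow> 'a \<times> (nat \<Rightarrow> nat)"
    where "h = (\<lambda>n p. (fst p, \<lambda>k. snd p (prod_encode (n, k))))"
  define D where "D = (\<Inter>n. h n -` C n)"
  have h: "continuous_on UNIV (h n)" for n
    unfolding h_def
    by (intro continuous_intros continuous_on_coordinatewise_then_product
        continuous_on_product_coordinate_comp)
  have "closed D"
    unfolding D_def by (intro closed_INT ballI closed_vimage h C(1))
  moreover have "(\<Inter>n. A n) = fst ` D"
  proof (intro equalityI subsetI)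
    fix x assume "x \<in> (\<Inter>n. A n)"
    then have "x \<in> fst ` C n" for n
      using C(2) by blast
    then have "\<exists>g. (x, g) \<in> C n" for n
      by (metis imageE prod.collapse)
    then obtain g where "\<And>n. (x, g n) \<in> C n"
      by metis
    then have "(x, \<lambda>m. g (fst (prod_decode m)) (snd (prod_decode m))) \<in> D"
      by (simp add: D_def h_def)
    then show "x \<in> fst ` D"
      by force
  qed (force simp: D_def h_def C(2))
  ultimately show ?thesis
    unfolding souslin_def by blast
qed

text \<open>
  The even entries of the code describe a point of the Cantor space, via the continuous
  surjection of \<open>\<nat>\<^sup>\<nat>\<close> onto it that tests each entry for zero; the odd entries are the witness.
\<close>

lemma souslin_projection:
  fixes B :: "('a::topological_space \<times> cantor) set"
  assumes "souslin B"
  shows "souslin (fst ` B)"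
proof -
  obtain C :: "(('a \<times> cantor) \<times> (nat \<Rightarrow> nat)) set" where C: "closed C" "B = fst ` C"
    using assms unfolding souslin_def by blast
  define h :: "'a \<times> (nat \<Rightarrow> nat) \<Rightarrow> ('a \<times> cantor) \<times> (nat \<Rightarrow> nat)"
    where "h = (\<lambda>p. ((fst p, \<lambda>k. snd p (2 * k) = 0), \<lambda>k. snd p (2 * k + 1)))"
  have zero_test: "continuous_on UNIV (\<lambda>n::nat. n = 0)"
    by (simp add: continuous_on_open_vimage open_discrete)
  have "continuous_on UNIV (\<lambda>p :: 'a \<times> (nat \<Rightarrow> nat). snd p (2 * k) = 0)" for k
    by (intro continuous_on_compose2[OF zero_test] subset_UNIV continuous_on_snd
        continuous_on_id continuous_on_product_coordinate_comp)
  then have even: "continuous_on UNIV (\<lambda>p :: 'a \<times> (nat \<Rightarrow> nat). \<lambda>k. snd p (2 * k) = 0)"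
    by (rule continuous_on_coordinatewise_then_product)
  have odd: "continuous_on UNIV (\<lambda>p :: 'a \<times> (nat \<Rightarrow> nat). \<lambda>k. snd p (2 * k + 1))"
    by (rule continuous_on_coordinatewise_then_product,
        rule continuous_on_product_coordinate_comp, intro continuous_on_snd continuous_on_id)
  have "continuous_on UNIV h"
    unfolding h_def by (intro continuous_on_Pair continuous_on_fst continuous_on_id even odd)
  then have "closed (h -` C)"
    by (rule closed_vimage[OF C(1)])
  moreover have "fst ` B = fst ` (h -` C)"
  proof (intro equalityI subsetI)
    fix x assume "x \<in> fst ` B"
    then obtain y g where "((x, y), g) \<in> C"
      using C(2) by auto
    then have "(x, \<lambda>m. if even m then of_bool (\<not> y (m div 2)) else g (m div 2)) \<in> h -` C"
      by (simp add: h_def)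
    then show "x \<in> fst ` (h -` C)"
      by force
  qed (force simp: h_def C(2))
  ultimately show ?thesis
    unfolding souslin_def by blast
qed


section \<open>Borel and analytic sets are Souslin\<close>

text \<open>
  With a countable base for \<^typ>\<open>bool\<close>, the Borel sets of the Cantor space and of its square
  are the product \<open>\<sigma>\<close>-algebras, generated by the conditions on single coordinates.
\<close>

instance bool :: second_countable_topology
proof
  obtain B :: "bool set set" where "topological_basis B"
    using topological_basis_trivial by blast
  then have "open = generate_topology B"
    by (rule topological_basis_imp_subbasis)
  moreover have "countable B"
    by (rule countable_finite) (rule finite)
  ultimately show "\<exists>B :: bool set set. countable B \<and> open = generate_topology B"
    by blast
qed

text \<open>
  Souslin sets are not closed under complements, so the induction over the Borel sets has to
  carry the complement along.
\<close>

lemma sigma_algebra_bi_souslin: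
  "sigma_algebra UNIV {S :: 'a::topological_space set. souslin S \<and> souslin (- S)}"
  unfolding sigma_algebra_iff2
proof (intro conjI ballI allI impI)
  fix A :: "nat \<Rightarrow> 'a set"
  assume "range A \<subseteq> {S. souslin S \<and> souslin (- S)}"
  then have "souslin (A n)" "souslin (- A n)" for n
    by auto
  then show "(\<Union>i. A i) \<in> {S. souslin S \<and> souslin (- S)}"
    by (simp add: souslin_UN souslin_INT)
qed (auto simp: closed_imp_souslin Compl_eq_Diff_UNIV[symmetric])

text \<open>
  With respect to the \<open>\<sigma>\<close>-algebra of bi-Souslin sets, every coordinate is measurable because
  conditions on it define clopen sets. Hence the identity is measurable into the Borel
  \<open>\<sigma>\<close>-algebra, which says that Borel sets are bi-Souslin.
\<close>

lemma borel_souslin: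
  fixes B :: "(cantor \<times> cantor) set"
  assumes "B \<in> sets borel"
  shows "souslin B"
proof -
  let ?S = "{S :: (cantor \<times> cantor) set. souslin S \<and> souslin (- S)}"
  define M where "M = sigma UNIV ?S"
  have sets_M: "sets M = ?S" and space_M: "space M = UNIV"
    unfolding M_def using sigma_algebra.sets_measure_of_eq[OF sigma_algebra_bi_souslin]
    by simp_all
  have coord: "f \<in> M \<rightarrow>\<^sub>M borel"
    if f: "continuous_on UNIV f" for f :: "cantor \<times> cantor \<Rightarrow> cantor"
  proof -
    have "{p. f p i \<in> V} \<in> ?S" for i V
    proof -
      have "{p. f p i \<in> W} = (\<lambda>p. f p i) -` W" for W
        by auto
      then have "closed {p. f p i \<in> W}" for W
        using continuous_on_product_coordinate_comp[OF f]
        by (simp add: closed_vimage closed_def[of W] open_discrete)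
      from this[of V] this[of "- V"] show ?thesis
        by (simp add: closed_imp_souslin Collect_neg_eq)
    qed
    then have "f \<in> M \<rightarrow>\<^sub>M PiM UNIV (\<lambda>_. borel)"
      by (intro measurable_PiM_single) (simp_all add: sets_M space_M)
    then show ?thesis
      using measurable_cong_sets[OF refl sets_PiM_equal_borel] by blast
  qed
  have "(\<lambda>p. (fst p, snd p)) \<in> M \<rightarrow>\<^sub>M borel \<Otimes>\<^sub>M borel"
    by (intro measurable_Pair coord continuous_intros)
  then have "(\<lambda>p. p) \<in> M \<rightarrow>\<^sub>M (borel :: (cantor \<times> cantor) measure)"
    by (simp add: borel_prod)
  from measurable_sets[OF this assms] have "B \<in> sets M"
    by (simp add: space_M)
  then show ?thesis
    by (simp add: sets_M)
qed

lemma analytic_set_souslin: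
  assumes "analytic_set A"
  shows "souslin A"
proof -
  obtain B where "B \<in> sets (borel :: (cantor \<times> cantor) measure)" "A = {x. \<exists>y. (x, y) \<in> B}"
    using assms unfolding analytic_set_def by blast
  moreover have "{x. \<exists>y. (x, y) \<in> B} = fst ` B"
    by force
  ultimately show ?thesis
    by (simp add: souslin_projection borel_souslin)
qed


section \<open>Separation by Borel sets\<close>

definition borel_separated :: "'a::topological_space set \<Rightarrow> 'a set \<Rightarrow> bool" where
  "borel_separated E E' \<longleftrightarrow> (\<exists>S \<in> sets borel. E \<subseteq> S \<and> S \<inter> E' = {})"

text \<open>
  This drives the construction of the branches: if every pair of pieces could be separated,
  the wholes could be.
\<close>

lemma borel_separated_UN:
  fixes E :: "'i::countable \<Rightarrow> 'a::topological_space set" and E' :: "'j::countable \<Rightarrow> 'a set"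
  assumes "\<And>i j. borel_separated (E i) (E' j)"
  shows "borel_separated (\<Union>i. E i) (\<Union>j. E' j)"
proof -
  obtain S where S: "\<And>i j. S i j \<in> sets borel" "\<And>i j. E i \<subseteq> S i j" "\<And>i j. S i j \<inter> E' j = {}"
    using assms unfolding borel_separated_def by metis
  have "(\<Union>i. \<Inter>j. S i j) \<in> sets borel"
    by (intro sets.countable_UN' sets.countable_INT'') (auto simp: S(1))
  moreover have "(\<Union>i. E i) \<subseteq> (\<Union>i. \<Inter>j. S i j)"
    using S(2) by blast
  moreover have "(\<Union>i. \<Inter>j. S i j) \<inter> (\<Union>j. E' j) = {}"
    using S(3) by blast
  ultimately show ?thesis
    unfolding borel_separated_def by blast
qed

text \<open>
  A prefix fixes entries of both components of the points of \<open>C\<close>. Fixing those of the witness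
  alone would not do: the first components of points of ever smaller pieces would then not
  have to converge.
\<close>

definition piece :: "(cantor \<times> (nat \<Rightarrow> nat)) set \<Rightarrow> nat \<Rightarrow> (nat \<Rightarrow> bool \<times> nat) \<Rightarrow> cantor set" where
  "piece C n s = {x. \<exists>g. (x, g) \<in> C \<and> (\<forall>i<n. (x i, g i) = s i)}"

lemma piece_0: "piece C 0 s = fst ` C"
  by (force simp: piece_def)

lemma piece_cong:
  assumes "\<And>i. i < n \<Longrightarrow> s i = t i"
  shows "piece C n s = piece C n t"
  using assms by (simp add: piece_def)

lemma piece_nth:
  assumes "x \<in> piece C n s" and "i < n"
  shows "x i = fst (s i)"
proof -
  obtain g :: "nat \<Rightarrow> nat" where "(x i, g i) = s i"
    using assms by (auto simp: piece_def)
  then show ?thesis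
    by (metis fst_conv)
qed

lemma piece_split: "piece C n s = (\<Union>v. piece C (Suc n) (s(n := v)))"
proof (intro equalityI subsetI)
  fix x assume "x \<in> piece C n s"
  then obtain g where "(x, g) \<in> C" "\<forall>i<n. (x i, g i) = s i"
    unfolding piece_def by blast
  then have "x \<in> piece C (Suc n) (s(n := (x n, g n)))"
    unfolding piece_def by (auto simp: less_Suc_eq)
  then show "x \<in> (\<Union>v. piece C (Suc n) (s(n := v)))"
    by blast
next
  fix x assume "x \<in> (\<Union>v. piece C (Suc n) (s(n := v)))"
  then obtain v g where "(x, g) \<in> C" and *: "\<forall>i<Suc n. (x i, g i) = (s(n := v)) i"
    unfolding piece_def by blast
  moreover have "(x i, g i) = s i" if "i < n" for i
    using *[rule_format, of i] that by simp
  ultimately show "x \<in> piece C n s"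
    unfolding piece_def by blast
qed

lemma tendsto_coordinatewise:
  fixes f :: "'a \<Rightarrow> 'i \<Rightarrow> 'b::topological_space"
  assumes "\<And>i. ((\<lambda>n. f n i) \<longlongrightarrow> l i) F"
  shows "(f \<longlongrightarrow> l) F"
proof -
  have "limitin (product_topology (\<lambda>_. euclidean) UNIV) f l F"
    using assms by (simp add: limitin_componentwise)
  then show ?thesis
    by (simp add: euclidean_product_topology)
qed

text \<open>
  Points of \<open>C\<close> chosen in the successive pieces agree with \<open>s\<close> on longer and longer prefixes, so
  they converge to the point that \<open>s\<close> describes, and \<open>C\<close> is closed.
\<close>

lemma limit_of_pieces:
  assumes "closed C" and "\<And>n. piece C n s \<noteq> {}"
  shows "(\<lambda>i. fst (s i)) \<in> fst ` C"
proof -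
  have "\<forall>n. \<exists>x g. (x, g) \<in> C \<and> (\<forall>i<n. (x i, g i) = s i)"
    using assms(2) by (force simp: piece_def)
  then obtain x g where xg: "\<And>n. (x n, g n) \<in> C" "\<And>n i. i < n \<Longrightarrow> (x n i, g n i) = s i"
    by metis
  have ev: "eventually (\<lambda>n. (x n i, g n i) = s i) sequentially" for i
    using eventually_gt_at_top[of i] by eventually_elim (rule xg(2))
  have "x \<longlonglongrightarrow> (\<lambda>i. fst (s i))"
  proof (rule tendsto_coordinatewise)
    show "(\<lambda>n. x n i) \<longlonglongrightarrow> fst (s i)" for i
      by (rule tendsto_eventually) (use ev[of i] in eventually_elim, metis fst_conv)
  qed
  moreover have "g \<longlonglongrightarrow> (\<lambda>i. snd (s i))"
  proof (rule tendsto_coordinatewise)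
    show "(\<lambda>n. g n i) \<longlonglongrightarrow> snd (s i)" for i
      by (rule tendsto_eventually) (use ev[of i] in eventually_elim, metis snd_conv)
  qed
  ultimately have "(\<lambda>n. (x n, g n)) \<longlonglongrightarrow> (\<lambda>i. fst (s i), \<lambda>i. snd (s i))"
    by (rule tendsto_Pair)
  from Lim_in_closed_set[OF assms(1) _ _ this] xg(1)
  have "(\<lambda>i. fst (s i), \<lambda>i. snd (s i)) \<in> C"
    by simp
  then show ?thesis
    by force
qed

text \<open>
  An inseparable pair of sets has an inseparable pair of pieces at the next level, so
  inseparability propagates along a pair of infinite branches.
\<close>

lemma inseparable_branches:
  assumes "\<not> borel_separated (fst ` C) (fst ` C')"
  obtains s s' where "\<And>n. \<not> borel_separated (piece C n s) (piece C' n s')"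
proof -
  \<comment> \<open>One sequence of pairs carries both branches; its \<open>n\<close>-th entry extends both prefixes.\<close>
  let ?insep = "\<lambda>n (f :: nat \<Rightarrow> (bool \<times> nat) \<times> (bool \<times> nat)).
    \<not> borel_separated (piece C n (fst \<circ> f)) (piece C' n (snd \<circ> f))"
  have "\<exists>f :: nat \<Rightarrow> (bool \<times> nat) \<times> (bool \<times> nat). \<forall>n. ?insep (Suc n) (f(n := f n))"
  proof (rule dependent_wellorder_choice)
    fix r n and f g :: "nat \<Rightarrow> (bool \<times> nat) \<times> (bool \<times> nat)"
    assume "\<And>m. m < n \<Longrightarrow> f m = g m"
    then have "piece C (Suc n) (fst \<circ> f(n := r)) = piece C (Suc n) (fst \<circ> g(n := r))"
      and "piece C' (Suc n) (snd \<circ> f(n := r)) = piece C' (Suc n) (snd \<circ> g(n := r))"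
      by (auto intro!: piece_cong simp: less_Suc_eq)
    then show "?insep (Suc n) (f(n := r)) = ?insep (Suc n) (g(n := r))"
      by simp
  next
    fix n and f :: "nat \<Rightarrow> (bool \<times> nat) \<times> (bool \<times> nat)"
    assume *: "\<And>m. m < n \<Longrightarrow> ?insep (Suc m) (f(m := f m))"
    have "?insep n f"
      using assms * by (cases n) (simp_all add: piece_0)
    then have "\<not> borel_separated (\<Union>v. piece C (Suc n) ((fst \<circ> f)(n := v)))
                                 (\<Union>w. piece C' (Suc n) ((snd \<circ> f)(n := w)))"
      by (simp only: piece_split[symmetric] not_False_eq_True)
    then obtain v w where "\<not> borel_separated (piece C (Suc n) ((fst \<circ> f)(n := v)))
                                             (piece C' (Suc n) ((snd \<circ> f)(n := w)))"
      using borel_separated_UN[of "\<lambda>v. piece C (Suc n) ((fst \<circ> f)(n := v))"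
          "\<lambda>w. piece C' (Suc n) ((snd \<circ> f)(n := w))"] by blast
    then have "?insep (Suc n) (f(n := (v, w)))"
      by (simp add: fun_upd_comp)
    then show "\<exists>r. ?insep (Suc n) (f(n := r))"
      by blast
  qed
  then obtain f where f: "\<And>n. ?insep (Suc n) f"
    by auto
  have "?insep n f" for n
    using assms f by (cases n) (simp_all add: piece_0)
  then show thesis
    by (rule that)
qed

lemma souslin_separation:
  fixes A A' :: "cantor set"
  assumes "souslin A" and "souslin A'" and "A \<inter> A' = {}"
  shows "borel_separated A A'"
proof (rule ccontr)
  assume "\<not> borel_separated A A'"
  moreover obtain C C' :: "(cantor \<times> (nat \<Rightarrow> nat)) set"
    where C: "closed C" "A = fst ` C" and C': "closed C'" "A' = fst ` C'"
    using assms(1,2) unfolding souslin_def by blast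
  ultimately obtain s s' where insep: "\<And>n. \<not> borel_separated (piece C n s) (piece C' n s')"
    using inseparable_branches by metis
  have "borel_separated {} E" "borel_separated E {}" for E :: "cantor set"
    unfolding borel_separated_def by auto
  then have "piece C n s \<noteq> {}" "piece C' n s' \<noteq> {}" for n
    using insep[of n] by metis+
  then have "(\<lambda>i. fst (s i)) \<in> A" "(\<lambda>i. fst (s' i)) \<in> A'"
    using C C' limit_of_pieces by simp_all
  then have "(\<lambda>i. fst (s i)) \<noteq> (\<lambda>i. fst (s' i))"
    using assms(3) by auto
  then obtain i where i: "fst (s i) \<noteq> fst (s' i)"
    by auto
  let ?S = "{u :: cantor. u i = fst (s i)}"
  have "?S = (\<lambda>u. u i) -` {fst (s i)}"
    by auto
  then have "open ?S"
    by (simp add: open_vimage open_discrete)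
  then have "?S \<in> sets borel"
    by (rule borel_open)
  moreover have "piece C (Suc i) s \<subseteq> ?S"
    using piece_nth[of _ C "Suc i" s i] by auto
  moreover have "?S \<inter> piece C' (Suc i) s' = {}"
    using i piece_nth[of _ C' "Suc i" s' i] by auto
  ultimately have "borel_separated (piece C (Suc i) s) (piece C' (Suc i) s')"
    unfolding borel_separated_def by (intro bexI[of _ ?S] conjI)
  with insep[of "Suc i"] show False
    by contradiction
qed

theorem theorem6p1:
  fixes A A' :: "cantor set"
  assumes "analytic_set A"
    and "analytic_set A'"
    and "A \<inter> A' = {}"
  shows "\<exists>S \<in> sets (borel :: cantor measure). A \<subseteq> S \<and> S \<inter> A' = {}"
  using souslin_separation[OF assms(1,2)[THEN analytic_set_souslin] assms(3)]
  unfolding borel_separated_def .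

end
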